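(* Assume the tree matrix is transient, and let $h:I\to\mathbb R$ be a bounded harmonic function. Then there exists a finite signed measure $\nu$ on $\partial_\infty$ such that $$h(i)=\int_{\partial_\infty}U_{i\xi}\,d\nu(\xi)\qquad\text{for every }i\in I$$ if and only if $$\sup_{n\ge1}\ \frac{1}{w_n-w_{n-1}}\sum_{j\in B^n}|h(j)-h(j^-)|<\infty .$$ In particular, if this last condition holds, then $h=h^+-h^-$ is the difference of two $\preceq$-increasing nonnegative harmonic functions $h^+,h^-$ given by the positive and negative parts of $\nu$, i.e. $h^{\pm}(i)=\int_{\partial_\infty}U_{i\xi}\,d\nu^{\pm}(\xi)$.
   Context: Tree and matrix. $(I,\mathcal T)$ is a connected, locally finite, non-oriented tree with countably infinite set of sites $I$ and root $r$, every branch being infinite (each site has at least one successor). $|i|$ is the distance from $i$ to $r$; $B^n=\{i\in I:|i|=n\}$; $i\preceq j$ means $i$ lies on the geodesic from $r$ to $j$, and $f$ is $\preceq$-increasing if $i\preceq j$ implies $f(i)\le f(j)$; $i^-$ ($i\ne r$) is the neighbour of $i$ closer to $r$; $S_i=\{j:j^-=i\}$. $w:\mathbb N=\{0,1,\dots\}\to(0,\infty)$ is strictly increasing, $w_{-1}=0$. The tree matrix is $U_{ij}=w_{|i\wedge j|}$, with $i\wedge j$ the common vertex, farthest from $r$, of the geodesics from $r$ to $i$ and $j$. The matrix $Q$ is: $Q_{ii^-}=Q_{i^-i}=(w_{|i|}-w_{|i|-1})^{-1}$ for $i\neq r$, $Q_{ii}=-\big((w_{|i|}-w_{|i|-1})^{-1}+|S_i|(w_{|i|+1}-w_{|i|})^{-1}\big)$,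 and $0$ otherwise. A function $h:I\to\mathbb R$ is harmonic if $\sum_jQ_{ij}h(j)=0$ for all $i\in I$ (including $i=r$). Boundary. $\partial_\infty$ is the set of infinite geodesic rays $\xi=(\xi(n))_{n\ge0}$ with $\xi(0)=r$, $\xi(n+1)\in S_{\xi(n)}$, with the compact topology (and Borel $\sigma$-field) generated by the sets $\partial_\infty(i)=\{\xi:\xi(|i|)=i\}$, $i\in I$. $U_{i\xi}=w_{|i\wedge\xi|}$, where $|i\wedge\xi|$ is the largest level of a common vertex of the geodesic from $r$ to $i$ and the ray $\xi$. Transience. Let $X$ be the minimal continuous-time Markov chain on $I$ with $q$-matrix $Q$, absorbed from $r$ at rate $1/w_0$ in an extra state $\partial_r$. The tree matrix is transient if, started at $r$, the probability of never being absorbed at $\partial_r$ is positive. *)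

theory Defs
  imports "HOL-Probability.Probability"
begin

section \<open>Rooted trees\<close>

text \<open>
  The set of sites is the whole type \<open>'i\<close>; \<open>T\<close> is the adjacency relation. A list of sites stands for
  a walk, whose number of steps is one less than the length of the list.
\<close>

definition walk :: "('i \<Rightarrow> 'i \<Rightarrow> bool) \<Rightarrow> 'i \<Rightarrow> 'i list \<Rightarrow> 'i \<Rightarrow> bool" where
  "walk T i p j \<longleftrightarrow> p \<noteq> [] \<and> hd p = i \<and> last p = j \<and> successively T p"

definition tree :: "('i \<Rightarrow> 'i \<Rightarrow> bool) \<Rightarrow> bool" where
  "tree T \<longleftrightarrow> symp T \<and> irreflp T \<and> (\<forall>i j. \<exists>!p. walk T i p j \<and> distinct p)"

definition graph_dist :: "('i \<Rightarrow> 'i \<Rightarrow> bool) \<Rightarrow> 'i \<Rightarrow> 'i \<Rightarrow> nat" where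
  "graph_dist T i j = (LEAST n. \<exists>p. walk T i p j \<and> length p = Suc n)"

definition geodesic :: "('i \<Rightarrow> 'i \<Rightarrow> bool) \<Rightarrow> 'i \<Rightarrow> 'i \<Rightarrow> 'i set" where
  "geodesic T i j = \<Union> {set p | p. walk T i p j \<and> length p = Suc (graph_dist T i j)}"

definition level :: "('i \<Rightarrow> 'i \<Rightarrow> bool) \<Rightarrow> 'i \<Rightarrow> 'i \<Rightarrow> nat" where
  "level T r i = graph_dist T i r"

definition sphere_at :: "('i \<Rightarrow> 'i \<Rightarrow> bool) \<Rightarrow> 'i \<Rightarrow> nat \<Rightarrow> 'i set" where
  "sphere_at T r n = {i. level T r i = n}"

definition tree_le :: "('i \<Rightarrow> 'i \<Rightarrow> bool) \<Rightarrow> 'i \<Rightarrow> 'i \<Rightarrow> 'i \<Rightarrow> bool" where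
  "tree_le T r i j \<longleftrightarrow> i \<in> geodesic T r j"

text \<open>The predecessor \<open>i\<^sup>-\<close>; it is only meaningful for \<open>i \<noteq> r\<close>.\<close>

definition parent :: "('i \<Rightarrow> 'i \<Rightarrow> bool) \<Rightarrow> 'i \<Rightarrow> 'i \<Rightarrow> 'i" where
  "parent T r i = (THE j. T i j \<and> level T r j < level T r i)"

definition successors :: "('i \<Rightarrow> 'i \<Rightarrow> bool) \<Rightarrow> 'i \<Rightarrow> 'i \<Rightarrow> 'i set" where
  "successors T r i = {j. j \<noteq> r \<and> parent T r j = i}"

definition admissible_tree :: "('i \<Rightarrow> 'i \<Rightarrow> bool) \<Rightarrow> 'i \<Rightarrow> bool" where
  "admissible_tree T r \<longleftrightarrow>
     tree T \<and> (\<forall>i. finite {j. T i j}) \<and>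
     countable (UNIV :: 'i set) \<and> infinite (UNIV :: 'i set) \<and>
     (\<forall>i. successors T r i \<noteq> {})"


section \<open>The q-matrix and harmonic functions\<close>

text \<open>\<open>weight_diff w n\<close> is \<open>w\<^sub>n - w\<^sub>n\<^sub>-\<^sub>1\<close>, under the convention that the value of \<open>w\<close> at \<open>-1\<close> is \<open>0\<close>.\<close>

definition weight_diff :: "(nat \<Rightarrow> real) \<Rightarrow> nat \<Rightarrow> real" where
  "weight_diff w n = w n - (if n = 0 then 0 else w (n - 1))"

definition Q_matrix :: "('i \<Rightarrow> 'i \<Rightarrow> bool) \<Rightarrow> 'i \<Rightarrow> (nat \<Rightarrow> real) \<Rightarrow> 'i \<Rightarrow> 'i \<Rightarrow> real" where
  "Q_matrix T r w i j =
     (if j = i then - (inverse (weight_diff w (level T r i)) +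
                       real (card (successors T r i)) * inverse (weight_diff w (level T r i + 1)))
      else if i \<noteq> r \<and> j = parent T r i then inverse (weight_diff w (level T r i))
      else if j \<noteq> r \<and> i = parent T r j then inverse (weight_diff w (level T r j))
      else 0)"

definition harmonic :: "('i \<Rightarrow> 'i \<Rightarrow> bool) \<Rightarrow> 'i \<Rightarrow> (nat \<Rightarrow> real) \<Rightarrow> ('i \<Rightarrow> real) \<Rightarrow> bool" where
  "harmonic T r w h \<longleftrightarrow> (\<forall>i. ((\<lambda>j. Q_matrix T r w i j * h j) has_sum 0) UNIV)"


section \<open>The minimal continuous-time Markov chain of a q-matrix\<close>

text \<open>
  Jump-and-hold construction for a stable conservative q-matrix \<open>q\<close> on a countable state space. An
  outcome \<open>\<omega>\<close> has two independent components. The first consists of independent variables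
  \<open>fst \<omega> (n, x)\<close>, distributed as row \<open>x\<close> of the jump matrix; the \<open>n\<close>-th jump, if it leaves \<open>x\<close>,
  leads to \<open>fst \<omega> (n, x)\<close>, so the visited states form a Markov chain with that jump matrix.
  The second consists of independent standard exponential variables, which are divided by the exit
  rates to give the holding times. An absorbing state has exit rate \<open>0\<close> and is held for an infinite
  time, because \<open>a / 0 = \<infinity>\<close> for \<open>a > 0\<close> in \<^typ>\<open>ennreal\<close>. From the explosion time on, the chain is
  in the state \<^const>\<open>None\<close>.
\<close>

definition exit_rate :: "('s \<Rightarrow> 's \<Rightarrow> real) \<Rightarrow> 's \<Rightarrow> real" where
  "exit_rate q x = - q x x"

definition jump_pmf :: "('s \<Rightarrow> 's \<Rightarrow> real) \<Rightarrow> 's \<Rightarrow> 's pmf" where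
  "jump_pmf q x =
     (if exit_rate q x = 0 then return_pmf x
      else embed_pmf (\<lambda>y. if y = x then 0 else q x y / exit_rate q x))"

definition chain_space :: "('s \<Rightarrow> 's \<Rightarrow> real) \<Rightarrow> ((nat \<times> 's \<Rightarrow> 's) \<times> (nat \<Rightarrow> real)) measure" where
  "chain_space q =
     (\<Pi>\<^sub>M nx\<in>UNIV. measure_pmf (jump_pmf q (snd nx))) \<Otimes>\<^sub>M
     (\<Pi>\<^sub>M n\<in>UNIV. density lborel (exponential_density 1))"

primrec jump_chain :: "'s \<Rightarrow> (nat \<times> 's \<Rightarrow> 's) \<times> (nat \<Rightarrow> real) \<Rightarrow> nat \<Rightarrow> 's" where
  "jump_chain x \<omega> 0 = x"
| "jump_chain x \<omega> (Suc n) = fst \<omega> (n, jump_chain x \<omega> n)"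

definition jump_time ::
  "('s \<Rightarrow> 's \<Rightarrow> real) \<Rightarrow> 's \<Rightarrow> (nat \<times> 's \<Rightarrow> 's) \<times> (nat \<Rightarrow> real) \<Rightarrow> nat \<Rightarrow> ennreal" where
  "jump_time q x \<omega> n =
     (\<Sum>k<n. ennreal (snd \<omega> k) / ennreal (exit_rate q (jump_chain x \<omega> k)))"

definition minimal_chain ::
  "('s \<Rightarrow> 's \<Rightarrow> real) \<Rightarrow> 's \<Rightarrow> real \<Rightarrow> (nat \<times> 's \<Rightarrow> 's) \<times> (nat \<Rightarrow> real) \<Rightarrow> 's option" where
  "minimal_chain q x t \<omega> =
     (if \<exists>n. jump_time q x \<omega> n \<le> ennreal t \<and> ennreal t < jump_time q x \<omega> (Suc n)
      then Some (jump_chain x \<omega>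
             (THE n. jump_time q x \<omega> n \<le> ennreal t \<and> ennreal t < jump_time q x \<omega> (Suc n)))
      else None)"


section \<open>Transience\<close>

text \<open>\<open>Absorbed\<close> is the extra state \<open>\<partial>\<^sub>r\<close>.\<close>

datatype 'i ext_site = Site 'i | Absorbed

fun absorbed_Q :: "('i \<Rightarrow> 'i \<Rightarrow> bool) \<Rightarrow> 'i \<Rightarrow> (nat \<Rightarrow> real) \<Rightarrow> 'i ext_site \<Rightarrow> 'i ext_site \<Rightarrow> real" where
  "absorbed_Q T r w (Site i) (Site j) = Q_matrix T r w i j"
| "absorbed_Q T r w (Site i) Absorbed = (if i = r then 1 / w 0 else 0)"
| "absorbed_Q T r w Absorbed y = 0"

definition transient :: "('i \<Rightarrow> 'i \<Rightarrow> bool) \<Rightarrow> 'i \<Rightarrow> (nat \<Rightarrow> real) \<Rightarrow> bool" where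
  "transient T r w \<longleftrightarrow>
     0 < measure (chain_space (absorbed_Q T r w))
       {\<omega> \<in> space (chain_space (absorbed_Q T r w)).
          \<forall>t\<ge>0. minimal_chain (absorbed_Q T r w) (Site r) t \<omega> \<noteq> Some Absorbed}"


section \<open>The boundary\<close>

definition tree_boundary :: "('i \<Rightarrow> 'i \<Rightarrow> bool) \<Rightarrow> 'i \<Rightarrow> (nat \<Rightarrow> 'i) set" where
  "tree_boundary T r = {\<xi>. \<xi> 0 = r \<and> (\<forall>n. \<xi> (Suc n) \<in> successors T r (\<xi> n))}"

definition boundary_at :: "('i \<Rightarrow> 'i \<Rightarrow> bool) \<Rightarrow> 'i \<Rightarrow> 'i \<Rightarrow> (nat \<Rightarrow> 'i) set" where
  "boundary_at T r i = {\<xi> \<in> tree_boundary T r. \<xi> (level T r i) = i}"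

text \<open>
  The measure carried by \<^const>\<open>sigma\<close> is irrelevant here, only the \<open>\<sigma>\<close>-field is used. It is the Borel
  \<open>\<sigma>\<close>-field, as the countably many sets \<open>boundary_at T r i\<close> form a base of the topology.
\<close>

definition boundary_space :: "('i \<Rightarrow> 'i \<Rightarrow> bool) \<Rightarrow> 'i \<Rightarrow> (nat \<Rightarrow> 'i) measure" where
  "boundary_space T r = sigma (tree_boundary T r) (range (boundary_at T r))"

definition U_boundary :: "('i \<Rightarrow> 'i \<Rightarrow> bool) \<Rightarrow> 'i \<Rightarrow> (nat \<Rightarrow> real) \<Rightarrow> 'i \<Rightarrow> (nat \<Rightarrow> 'i) \<Rightarrow> real" where
  "U_boundary T r w i \<xi> = w (Max (level T r ` (geodesic T r i \<inter> range \<xi>)))"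


section \<open>Finite signed measures\<close>

definition finite_signed_measure :: "'a measure \<Rightarrow> ('a set \<Rightarrow> real) \<Rightarrow> bool" where
  "finite_signed_measure M \<nu> \<longleftrightarrow>
     \<nu> {} = 0 \<and>
     (\<forall>A. range A \<subseteq> sets M \<longrightarrow> disjoint_family A \<longrightarrow> (\<lambda>n::nat. \<nu> (A n)) sums \<nu> (\<Union>n. A n))"

text \<open>
  The Jordan decomposition: \<open>\<nu>\<^sup>+ A\<close> is the supremum of \<open>\<nu> B\<close> over the measurable \<open>B \<subseteq> A\<close>. Truncating
  negative values to \<open>0\<close> does not change it, since \<open>B = {}\<close> is allowed.
\<close>

definition positive_part :: "'a measure \<Rightarrow> ('a set \<Rightarrow> real) \<Rightarrow> 'a measure" where
  "positive_part M \<nu> =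
     measure_of (space M) (sets M) (\<lambda>A. SUP B\<in>{B \<in> sets M. B \<subseteq> A}. ennreal (\<nu> B))"

definition negative_part :: "'a measure \<Rightarrow> ('a set \<Rightarrow> real) \<Rightarrow> 'a measure" where
  "negative_part M \<nu> = positive_part M (\<lambda>A. - \<nu> A)"

definition signed_integral :: "'a measure \<Rightarrow> ('a set \<Rightarrow> real) \<Rightarrow> ('a \<Rightarrow> real) \<Rightarrow> real" where
  "signed_integral M \<nu> f =
     (\<integral>x. f x \<partial>positive_part M \<nu>) - (\<integral>x. f x \<partial>negative_part M \<nu>)"

text \<open>
  For a tree matrix, \<open>\<xi> \<mapsto> U\<^sub>i\<^sub>\<xi>\<close> is bounded and measurable, hence integrable with respect to both parts.
\<close>

definition represents ::
  "('i \<Rightarrow> 'i \<Rightarrow> bool) \<Rightarrow> 'i \<Rightarrow> (nat \<Rightarrow> real) \<Rightarrow> ((nat \<Rightarrow> 'i) set \<Rightarrow> real) \<Rightarrow> ('i \<Rightarrow> real) \<Rightarrow> bool" where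
  "represents T r w \<nu> h \<longleftrightarrow>
     finite_signed_measure (boundary_space T r) \<nu> \<and>
     (\<forall>i. h i = signed_integral (boundary_space T r) \<nu> (U_boundary T r w i))"

end

theory Submission
  imports Defs
begin

text \<open>
  Put \<open>u i = (h i - h i\<^sup>-) / (w\<^sub>|\<^sub>i\<^sub>| - w\<^sub>|\<^sub>i\<^sub>|\<^sub>-\<^sub>1)\<close>, with \<open>h\<close> extended by \<open>0\<close> above the root.
  Then \<open>h\<close> is harmonic iff \<open>u\<close> is a flow: its value at a site is the sum of its values at the successors. Since
  \<open>U\<^sub>i\<^sub>\<xi>\<close> is the sum of the weight differences over the common vertices of the geodesic to \<open>i\<close> and
  the ray \<open>\<xi>\<close>, a signed measure \<open>\<nu>\<close> represents \<open>h\<close> iff its value on the rays through \<open>i\<close> is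
  \<open>u i\<close>, for every \<open>i\<close>. A flow comes from a signed measure iff its sums of absolute values over the
  spheres are bounded: such a flow is the difference of two nonnegative ones, and a nonnegative flow
  is, up to normalisation, the law of a random ray.
\<close>

section \<open>Jordan decomposition of a finite signed measure\<close>

lemma signed_measure_empty: "finite_signed_measure M \<nu> \<Longrightarrow> \<nu> {} = 0"
  by (simp add: finite_signed_measure_def)

lemma signed_measure_sums:
  "finite_signed_measure M \<nu> \<Longrightarrow> range A \<subseteq> sets M \<Longrightarrow> disjoint_family A \<Longrightarrow>
    (\<lambda>n::nat. \<nu> (A n)) sums \<nu> (\<Union>n. A n)"
  by (simp add: finite_signed_measure_def)

lemma signed_measure_uminus: "finite_signed_measure M \<nu> \<Longrightarrow> finite_signed_measure M (\<lambda>A. - \<nu> A)"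
  by (simp add: finite_signed_measure_def sums_minus)

lemma signed_measure_Un:
  assumes "finite_signed_measure M \<nu>" "A \<in> sets M" "B \<in> sets M" "A \<inter> B = {}"
  shows "\<nu> (A \<union> B) = \<nu> A + \<nu> B"
proof -
  have "(\<lambda>n. \<nu> (binaryset A B n)) sums \<nu> (\<Union>n. binaryset A B n)"
    by (rule signed_measure_sums[OF assms(1)])
      (use assms in \<open>auto simp: binaryset_def disjoint_family_on_def range_binaryset_eq\<close>)
  then show ?thesis
    using binaryset_sums[of \<nu> A B] signed_measure_empty[OF assms(1)]
    by (simp add: UN_binaryset_eq sums_unique2)
qed

lemma signed_measure_Diff:
  assumes "finite_signed_measure M \<nu>" "A \<in> sets M" "B \<in> sets M" "B \<subseteq> A"
  shows "\<nu> (A - B) = \<nu> A - \<nu> B"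
proof -
  have "\<nu> (B \<union> (A - B)) = \<nu> B + \<nu> (A - B)"
    using assms by (intro signed_measure_Un) auto
  then show ?thesis using assms(4) by (simp add: Un_absorb1)
qed

text \<open>If \<open>\<nu>\<close> were unbounded, one could split off, again and again, a set of mass at least \<open>1\<close> in
  absolute value from a set on which \<open>\<nu>\<close> remains unbounded; the mass of the disjoint union of
  these sets would be a series whose terms do not tend to \<open>0\<close>.\<close>

lemma signed_measure_bounded:
  assumes fsm: "finite_signed_measure M \<nu>"
  shows "\<exists>C. \<forall>A\<in>sets M. \<bar>\<nu> A\<bar> \<le> C"
proof (rule ccontr)
  define bdd where "bdd E \<longleftrightarrow> (\<exists>C. \<forall>X\<in>sets M. X \<subseteq> E \<longrightarrow> \<bar>\<nu> X\<bar> \<le> C)" for E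
  assume "\<not> ?thesis"
  then have space: "\<not> bdd (space M)"
    using sets.sets_into_space by (fastforce simp: bdd_def)
  have split: "\<exists>E'. (E' \<in> sets M \<and> \<not> bdd E') \<and> E' \<subseteq> E \<and> 1 \<le> \<bar>\<nu> (E - E')\<bar>"
    if E: "E \<in> sets M \<and> \<not> bdd E" for E
  proof -
    \<comment> \<open>The threshold \<open>\<bar>\<nu> E\<bar> + 1\<close> gives both
      \<open>B\<close> and \<open>E - B\<close> mass at least 1 in absolute value, so an unbounded
      half can be kept and the other one split off.\<close>
    have "\<not> (\<forall>X\<in>sets M. X \<subseteq> E \<longrightarrow> \<bar>\<nu> X\<bar> \<le> \<bar>\<nu> E\<bar> + 1)"
      using E unfolding bdd_def by blast
    then obtain B where B: "B \<in> sets M" "B \<subseteq> E" "\<bar>\<nu> E\<bar> + 1 < \<bar>\<nu> B\<bar>"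
      by (auto simp: not_le)
    have "\<not> bdd B \<or> \<not> bdd (E - B)"
    proof (rule ccontr)
      assume "\<not> (\<not> bdd B \<or> \<not> bdd (E - B))"
      then obtain C D where
        C: "\<forall>X\<in>sets M. X \<subseteq> B \<longrightarrow> \<bar>\<nu> X\<bar> \<le> C" and
        D: "\<forall>X\<in>sets M. X \<subseteq> E - B \<longrightarrow> \<bar>\<nu> X\<bar> \<le> D"
        unfolding bdd_def by blast
      have "\<bar>\<nu> X\<bar> \<le> C + D" if X: "X \<in> sets M" "X \<subseteq> E" for X
      proof -
        have "\<nu> ((X \<inter> B) \<union> (X - B)) = \<nu> (X \<inter> B) + \<nu> (X - B)"
          by (rule signed_measure_Un[OF fsm]) (use X B in auto)
        moreover have "(X \<inter> B) \<union> (X - B) = X" by auto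
        moreover have "\<bar>\<nu> (X \<inter> B)\<bar> \<le> C"
          using C X B(1) sets.Int[of X M B] Int_lower2[of X B] by blast
        moreover have "\<bar>\<nu> (X - B)\<bar> \<le> D"
          using D X B(1) sets.Diff[of X M B] Diff_mono[of X E B B] by blast
        ultimately show ?thesis by simp
      qed
      then have "bdd E" unfolding bdd_def by blast
      then show False using E by blast
    qed
    then show ?thesis
    proof
      assume "\<not> bdd B"
      moreover have "1 \<le> \<bar>\<nu> (E - B)\<bar>"
        using signed_measure_Diff[OF fsm conjunct1[OF E] B(1,2)] B(3) by linarith
      ultimately show ?thesis using B by blast
    next
      assume "\<not> bdd (E - B)"
      moreover have "E - (E - B) = B" using B(2) by blast
      moreover have "1 \<le> \<bar>\<nu> B\<bar>" using B(3) by linarith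
      ultimately show ?thesis using B E by (intro exI[of _ "E - B"]) (simp add: sets.Diff)
    qed
  qed
  obtain E where E: "\<And>n::nat. E n \<in> sets M \<and> \<not> bdd (E n)"
    "\<And>n. E (Suc n) \<subseteq> E n \<and> 1 \<le> \<bar>\<nu> (E n - E (Suc n))\<bar>"
    by (rule dependent_nat_choice[of "\<lambda>_ E. E \<in> sets M \<and> \<not> bdd E"
        "\<lambda>_ E E'. E' \<subseteq> E \<and> 1 \<le> \<bar>\<nu> (E - E')\<bar>", THEN exE])
      (use space split in \<open>blast+\<close>)
  have mono: "E n \<subseteq> E m" if "m \<le> n" for m n
    by (rule lift_Suc_antimono_le[of E, OF _ that]) (simp add: E(2))
  have "disjoint_family (\<lambda>n. E n - E (Suc n))"
    unfolding disjoint_family_on_def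
  proof (intro ballI impI)
    fix m n :: nat assume "m \<noteq> n"
    then consider "Suc m \<le> n" | "Suc n \<le> m" by linarith
    then show "(E m - E (Suc m)) \<inter> (E n - E (Suc n)) = {}"
      by cases (use mono in blast)+
  qed
  then have "(\<lambda>n. \<nu> (E n - E (Suc n))) sums \<nu> (\<Union>n. E n - E (Suc n))"
    by (intro signed_measure_sums[OF fsm]) (use E(1) in auto)
  then have "(\<lambda>n. \<nu> (E n - E (Suc n))) \<longlonglongrightarrow> 0"
    by (intro summable_LIMSEQ_zero) (rule sums_summable)
  then have "eventually (\<lambda>n. \<bar>\<nu> (E n - E (Suc n))\<bar> < 1) sequentially"
    by (auto dest!: tendstoD[of _ 0 sequentially 1])
  then obtain n where "\<bar>\<nu> (E n - E (Suc n))\<bar> < 1"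
    using eventually_happens'[OF sequentially_bot] by blast
  then show False using E(2)[of n] by linarith
qed

text \<open>Only an inequality, since \<open>ennreal\<close> truncates: a negative summand lowers
  the left side but counts as 0 on the right.\<close>

lemma ennreal_add_le: "ennreal (a + b) \<le> ennreal a + ennreal b"
proof -
  have "ennreal (a + b) \<le> ennreal (max 0 a + max 0 b)" by (intro ennreal_leI) auto
  then show ?thesis by (simp add: ennreal_plus ennreal_max_0)
qed

lemma ennreal_sum_le: "ennreal (\<Sum>i\<in>I. f i) \<le> (\<Sum>i\<in>I. ennreal (f i))"
proof (induction I rule: infinite_finite_induct)
  case (insert x I)
  then show ?case
    using ennreal_add_le[of "f x" "sum f I"] by (simp add: order_trans[OF _ add_left_mono])
qed auto

lemma space_positive_part [simp]: "space (positive_part M \<nu>) = space M"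
  by (simp add: positive_part_def space_measure_of sets.space_closed)

lemma sets_positive_part [simp, measurable_cong]: "sets (positive_part M \<nu>) = sets M"
  by (simp add: positive_part_def sets_measure_of sets.space_closed)

text \<open>\<open>measure_of\<close> takes the prescribed values only once countable additivity is
  known. The supremum is superadditive on disjoint sets, which gives one inequality; cutting a
  measurable \<open>B\<close> along the \<open>A i\<close> gives the other.\<close>

lemma emeasure_positive_part:
  assumes fsm: "finite_signed_measure M \<nu>" and "A \<in> sets M"
  shows "emeasure (positive_part M \<nu>) A = (SUP B\<in>{B \<in> sets M. B \<subseteq> A}. ennreal (\<nu> B))"
proof -
  define P where "P A = (SUP B\<in>{B \<in> sets M. B \<subseteq> A}. ennreal (\<nu> B))" for A
  have upper: "ennreal (\<nu> B) \<le> P A" if "B \<in> sets M" "B \<subseteq> A" for A B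
    unfolding P_def by (rule SUP_upper) (use that in auto)
  have mono: "P A \<le> P B" if "A \<subseteq> B" for A B
    unfolding P_def by (rule SUP_subset_mono) (use that in auto)
  have Un: "P A + P B \<le> P (A \<union> B)" if AB: "A \<inter> B = {}" for A B
  proof -
    have "ennreal (\<nu> X) + ennreal (\<nu> Y) \<le> P (A \<union> B)"
      if XY: "X \<in> sets M" "X \<subseteq> A" "Y \<in> sets M" "Y \<subseteq> B" for X Y
    proof -
      \<comment> \<open>Replacing a set of negative mass by \<open>{}\<close> keeps the truncated
        value and makes both masses nonnegative, so that \<open>ennreal\<close> adds them
        exactly.\<close>
      define X' where "X' = (if \<nu> X < 0 then {} else X)"
      define Y' where "Y' = (if \<nu> Y < 0 then {} else Y)"
      have *: "X' \<in> sets M" "X' \<subseteq> A" "Y' \<in> sets M" "Y' \<subseteq> B" "0 \<le> \<nu> X'" "0 \<le> \<nu> Y'"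
        "ennreal (\<nu> X) = ennreal (\<nu> X')" "ennreal (\<nu> Y) = ennreal (\<nu> Y')"
        using XY signed_measure_empty[OF fsm] by (auto simp: X'_def Y'_def ennreal_neg)
      then have "\<nu> (X' \<union> Y') = \<nu> X' + \<nu> Y'"
        using AB by (intro signed_measure_Un[OF fsm]) auto
      then show ?thesis
        using * upper[of "X' \<union> Y'" "A \<union> B"] by (simp add: ennreal_plus le_supI1 le_supI2)
    qed
    note XY = this
    have ne: "{B \<in> sets M. B \<subseteq> A} \<noteq> {}" for A by auto
    have "ennreal (\<nu> X) + P B \<le> P (A \<union> B)" if "X \<in> sets M" "X \<subseteq> A" for X
      unfolding P_def[of B] ennreal_SUP_add_right[OF ne]
      by (rule SUP_least) (use that XY in auto)
    then show ?thesis
      unfolding P_def[of A] ennreal_SUP_add_left[OF ne, symmetric]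
      by (intro SUP_least) auto
  qed
  have "countably_additive (sets M) P"
  proof (rule countably_additiveI)
    fix A :: "nat \<Rightarrow> 'a set"
    assume A: "range A \<subseteq> sets M" "disjoint_family A" "(\<Union>i. A i) \<in> sets M"
    show "(\<Sum>i. P (A i)) = P (\<Union>i. A i)"
    proof (rule antisym)
      have "(\<Sum>i<n. P (A i)) \<le> P (\<Union>i<n. A i)" for n
      proof (induction n)
        case (Suc n)
        have "A i \<inter> A n = {}" if "i < n" for i
          using that by (intro disjoint_family_onD[OF A(2)]) auto
        then have "(\<Union>i<n. A i) \<inter> A n = {}" by blast
        then have "P (\<Union>i<n. A i) + P (A n) \<le> P (\<Union>i<Suc n. A i)"
          using Un[of "\<Union>i<n. A i" "A n"] by (simp add: lessThan_Suc Un_commute)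
        moreover have "(\<Sum>i<Suc n. P (A i)) \<le> P (\<Union>i<n. A i) + P (A n)"
          using add_right_mono[OF Suc] by simp
        ultimately show ?case by (rule order_trans[rotated])
      qed auto
      moreover have "P (\<Union>i<n. A i) \<le> P (\<Union>i. A i)" for n by (rule mono) blast
      ultimately have "(\<Sum>i<n. P (A i)) \<le> P (\<Union>i. A i)" for n by (rule order_trans)
      then show "(\<Sum>i. P (A i)) \<le> P (\<Union>i. A i)"
        by (rule suminf_le_const[OF summableI])
      show "P (\<Union>i. A i) \<le> (\<Sum>i. P (A i))"
        unfolding P_def[of "\<Union>i. A i"]
      proof (rule SUP_least, clarify)
        fix B assume B: "B \<in> sets M" "B \<subseteq> (\<Union>i. A i)"
        \<comment> \<open>\<open>\<nu> B\<close> is the limit of the partial sums over the pieces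
          \<open>B \<inter> A i\<close>, and each partial sum is at most the series of the
          \<open>P (A i)\<close>.\<close>
        have "disjoint_family (\<lambda>i. B \<inter> A i)"
          by (rule disjoint_family_on_bisimulation[OF A(2)]) blast
        then have "(\<lambda>i. \<nu> (B \<inter> A i)) sums \<nu> (\<Union>i. B \<inter> A i)"
          using A(1) B(1) by (intro signed_measure_sums[OF fsm]) auto
        moreover have "(\<Union>i. B \<inter> A i) = B" using B by auto
        ultimately have "(\<lambda>n. ennreal (\<Sum>i<n. \<nu> (B \<inter> A i))) \<longlonglongrightarrow> ennreal (\<nu> B)"
          by (intro tendsto_ennrealI) (simp add: sums_def)
        moreover have "ennreal (\<Sum>i<n. \<nu> (B \<inter> A i)) \<le> (\<Sum>i. P (A i))" for n
        proof -
          have "ennreal (\<Sum>i<n. \<nu> (B \<inter> A i)) \<le> (\<Sum>i<n. ennreal (\<nu> (B \<inter> A i)))"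
            by (rule ennreal_sum_le)
          also have "\<dots> \<le> (\<Sum>i<n. P (A i))"
            using A(1) B(1) by (intro sum_mono upper) auto
          also have "\<dots> \<le> (\<Sum>i. P (A i))"
            by (intro sum_le_suminf) auto
          finally show ?thesis .
        qed
        ultimately show "ennreal (\<nu> B) \<le> (\<Sum>i. P (A i))"
          by (intro LIMSEQ_le_const2) auto
      qed
    qed
  qed
  moreover have "positive (sets M) P"
  proof -
    have "{B \<in> sets M. B \<subseteq> {}} = {{}}" by auto
    then show ?thesis using signed_measure_empty[OF fsm] by (simp add: positive_def P_def)
  qed
  moreover have "positive_part M \<nu> = measure_of (space M) (sets M) P"
    unfolding positive_part_def P_def ..
  ultimately have "emeasure (positive_part M \<nu>) A = P A"
    by (intro emeasure_measure_of[OF _ sets.space_closed]) (simp_all add: \<open>A \<in> sets M\<close>)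
  then show ?thesis by (simp add: P_def)
qed

lemma finite_measure_positive_part:
  assumes "finite_signed_measure M \<nu>"
  shows "finite_measure (positive_part M \<nu>)"
proof (rule finite_measureI)
  obtain C where C: "\<forall>A\<in>sets M. \<bar>\<nu> A\<bar> \<le> C"
    using signed_measure_bounded[OF assms] by blast
  have "emeasure (positive_part M \<nu>) (space M) \<le> ennreal C"
    unfolding emeasure_positive_part[OF assms sets.top]
    by (rule SUP_least) (use C in \<open>force intro!: ennreal_leI\<close>)
  then show "emeasure (positive_part M \<nu>) (space (positive_part M \<nu>)) \<noteq> \<infinity>"
    by (auto simp: top_unique)
qed

text \<open>For measurable \<open>B \<subseteq> A\<close>,
  \<open>\<nu> B = \<nu> A - \<nu> (A - B)\<close>, and \<open>- \<nu> (A - B)\<close> is at most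
  the negative part of \<open>A\<close>; then take the supremum over \<open>B\<close>. Combined with
  the same bound for \<open>- \<nu>\<close>, this yields the Jordan decomposition.\<close>

lemma measure_positive_part_le:
  assumes "finite_signed_measure M \<nu>" "A \<in> sets M"
  shows "measure (positive_part M \<nu>) A \<le> \<nu> A + measure (negative_part M \<nu>) A"
proof -
  interpret N: finite_measure "negative_part M \<nu>"
    unfolding negative_part_def by (intro finite_measure_positive_part signed_measure_uminus assms)
  interpret P: finite_measure "positive_part M \<nu>"
    by (intro finite_measure_positive_part assms)
  have N: "- \<nu> B \<le> measure (negative_part M \<nu>) A" if "B \<in> sets M" "B \<subseteq> A" for B
  proof -
    have "ennreal (- \<nu> B) \<le> emeasure (negative_part M \<nu>) A"
      unfolding negative_part_def emeasure_positive_part[OF signed_measure_uminus[OF assms(1)] assms(2)]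
      by (rule SUP_upper) (use that in auto)
    then show ?thesis
      by (simp add: N.emeasure_eq_measure ennreal_le_iff)
  qed
  \<comment> \<open>Truncation in \<open>ennreal\<close> hides the sign; this fact lets the final
    bound be read back over the reals.\<close>
  have nonneg: "0 \<le> \<nu> A + measure (negative_part M \<nu>) A"
    using N[of A] assms by simp
  have "emeasure (positive_part M \<nu>) A \<le> ennreal (\<nu> A + measure (negative_part M \<nu>) A)"
    unfolding emeasure_positive_part[OF assms]
  proof (rule SUP_least, clarify)
    fix B assume B: "B \<in> sets M" "B \<subseteq> A"
    then show "ennreal (\<nu> B) \<le> ennreal (\<nu> A + measure (negative_part M \<nu>) A)"
      using N[of "A - B"] assms signed_measure_Diff[OF assms B] by (intro ennreal_leI) auto
  qed
  then show ?thesis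
    using nonneg by (simp add: P.emeasure_eq_measure ennreal_le_iff)
qed

lemma jordan_decomposition:
  assumes "finite_signed_measure M \<nu>" "A \<in> sets M"
  shows "\<nu> A = measure (positive_part M \<nu>) A - measure (negative_part M \<nu>) A"
  using measure_positive_part_le[OF assms] measure_positive_part_le[OF signed_measure_uminus[OF assms(1)] assms(2)]
  by (simp add: negative_part_def)

section \<open>Ancestors and rays in a rooted tree\<close>

locale rooted_tree =
  fixes T :: "'i \<Rightarrow> 'i \<Rightarrow> bool" and r :: 'i
  assumes admissible: "admissible_tree T r"
begin

abbreviation lev :: "'i \<Rightarrow> nat" where "lev \<equiv> level T r"
abbreviation par :: "'i \<Rightarrow> 'i" where "par \<equiv> parent T r"
abbreviation succs :: "'i \<Rightarrow> 'i set" where "succs \<equiv> successors T r"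
abbreviation sphere :: "nat \<Rightarrow> 'i set" where "sphere \<equiv> sphere_at T r"

lemma tree: "tree T"
  and finite_neighbours: "finite {j. T i j}"
  and successors_nonempty: "succs i \<noteq> {}"
  using admissible by (auto simp: admissible_tree_def)

section \<open>Walks, levels and parents\<close>

lemma adj_sym: "T i j \<Longrightarrow> T j i"
  using tree by (auto simp: tree_def dest: sympD)

lemma walk_exists: "\<exists>p. walk T i p j"
  using tree unfolding tree_def by blast

lemma distinct_walk_unique:
  "walk T i p j \<Longrightarrow> walk T i q j \<Longrightarrow> distinct p \<Longrightarrow> distinct q \<Longrightarrow> p = q"
  using tree unfolding tree_def by blast

lemma walk_Cons: "T i j \<Longrightarrow> walk T j p k \<Longrightarrow> walk T i (i # p) k"
  by (auto simp: walk_def successively_Cons)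

lemma walk_rev: "walk T i p j \<Longrightarrow> walk T j (rev p) i"
  by (auto simp: walk_def hd_rev last_rev intro: adj_sym elim: successively_mono)

lemma graph_dist_le: "walk T i p j \<Longrightarrow> length p = Suc n \<Longrightarrow> graph_dist T i j \<le> n"
  unfolding graph_dist_def by (rule Least_le) blast

lemma shortest_walk_exists: "\<exists>p. walk T i p j \<and> length p = Suc (graph_dist T i j)"
proof -
  obtain p where "walk T i p j" using walk_exists by blast
  then have "\<exists>n p. walk T i p j \<and> length p = Suc n"
    by (metis Suc_pred length_greater_0_conv walk_def)
  then show ?thesis
    unfolding graph_dist_def by (rule LeastI_ex)
qed

lemma graph_dist_sym: "graph_dist T i j = graph_dist T j i"
  by (metis graph_dist_le shortest_walk_exists walk_rev length_rev order_antisym)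

lemma level_root [simp]: "lev r = 0"
  using graph_dist_le[of r "[r]" r 0] by (simp add: level_def walk_def)

lemma level_eq_0_iff [simp]: "lev i = 0 \<longleftrightarrow> i = r"
proof
  assume "lev i = 0"
  then obtain p where "walk T i p r" "length p = Suc 0"
    using shortest_walk_exists[of i r] by (auto simp: level_def)
  then show "i = r" by (auto simp: walk_def length_Suc_conv)
qed simp

lemma level_adj_le: "T i j \<Longrightarrow> lev i \<le> Suc (lev j)"
  using shortest_walk_exists[of j r] graph_dist_le[OF walk_Cons] by (fastforce simp: level_def)

text \<open>The tail shows that \<open>lev j\<close> is less than \<open>lev i\<close>, and adjacent
  levels differ by at most one. So the tail is again shortest, ready for induction on the
  level.\<close>

lemma shortest_walk_Cons:
  assumes "walk T i p r" "length p = Suc (lev i)" "i \<noteq> r"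
  obtains j q where "p = i # q" "T i j" "walk T j q r" "lev i = Suc (lev j)" "length q = Suc (lev j)"
proof -
  obtain n where n: "lev i = Suc n" using assms(3) by (cases "lev i") auto
  then obtain j q where p: "p = i # j # q"
    using assms(1,2) by (auto simp: walk_def length_Suc_conv)
  then have j: "T i j" "walk T j (j # q) r"
    using assms(1) by (auto simp: walk_def)
  have "lev j \<le> n"
    using graph_dist_le[OF j(2), of n] assms(2) p n by (simp add: level_def)
  moreover have "n \<le> lev j" using level_adj_le[OF j(1)] n by simp
  ultimately show thesis using that[OF p j] n assms(2) p by simp
qed

text \<open>The level bound guarantees that a site of higher level put in front keeps the walk free
  of repetitions.\<close>

lemma descending_walk_exists:
  "\<exists>p. walk T i p r \<and> distinct p \<and> (\<forall>x\<in>set p. lev x \<le> lev i)"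
proof (induction "lev i" arbitrary: i)
  case 0
  then show ?case by (intro exI[of _ "[r]"]) (simp add: walk_def)
next
  case (Suc n)
  obtain p where "walk T i p r" "length p = Suc (lev i)"
    using shortest_walk_exists[of i r] by (auto simp: level_def)
  moreover have "i \<noteq> r" using Suc(2) by auto
  ultimately obtain j where j: "T i j" "lev i = Suc (lev j)" by (rule shortest_walk_Cons)
  then obtain q where q: "walk T j q r" "distinct q" "\<forall>x\<in>set q. lev x \<le> lev j"
    using Suc(1)[of j] Suc(2) by auto
  then have "i \<notin> set q" using j by auto
  then show ?case
    using q j walk_Cons by (intro exI[of _ "i # q"]) auto
qed

text \<open>Two lower neighbours would start two different repetition-free walks from
  \<open>i\<close> to \<open>r\<close>. This makes the description in \<open>parent\<close>
  definite.\<close>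

lemma lower_neighbour_unique:
  assumes "T i j" "lev j < lev i" "T i k" "lev k < lev i"
  shows "j = k"
proof -
  obtain p where p: "walk T j p r" "distinct p" "\<forall>x\<in>set p. lev x \<le> lev j"
    using descending_walk_exists by blast
  obtain q where q: "walk T k q r" "distinct q" "\<forall>x\<in>set q. lev x \<le> lev k"
    using descending_walk_exists by blast
  have "i # p = i # q"
    using p q assms by (intro distinct_walk_unique[of i _ r] walk_Cons) auto
  then show ?thesis using p(1) q(1) by (auto simp: walk_def)
qed

lemma parent_eqI: "T i j \<Longrightarrow> lev j < lev i \<Longrightarrow> par i = j"
  unfolding parent_def using lower_neighbour_unique by blast

lemma
  assumes "i \<noteq> r"
  shows adj_parent: "T i (par i)" and level_parent: "lev i = Suc (lev (par i))"
proof -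
  obtain p where "walk T i p r" "length p = Suc (lev i)"
    using shortest_walk_exists[of i r] by (auto simp: level_def)
  from shortest_walk_Cons[OF this assms] obtain j where "T i j" "lev i = Suc (lev j)" .
  with parent_eqI[of i j] show "T i (par i)" "lev i = Suc (lev (par i))" by auto
qed

lemma mem_successors_iff: "j \<in> succs i \<longleftrightarrow> j \<noteq> r \<and> par j = i"
  by (simp add: successors_def)

lemma level_successor: "j \<in> succs i \<Longrightarrow> lev j = Suc (lev i)"
  using level_parent by (auto simp: mem_successors_iff)

lemma finite_successors [simp]: "finite (succs i)"
  by (rule finite_subset[OF _ finite_neighbours[of i]])
    (use adj_parent adj_sym in \<open>auto simp: mem_successors_iff\<close>)

lemma mem_sphere_iff: "i \<in> sphere n \<longleftrightarrow> lev i = n"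
  by (simp add: sphere_at_def)

lemma sphere_0: "sphere 0 = {r}"
  by (auto simp: mem_sphere_iff)

lemma sphere_Suc: "sphere (Suc n) = (\<Union>i\<in>sphere n. succs i)"
proof -
  have "j \<in> (\<Union>i\<in>sphere n. succs i)" if "lev j = Suc n" for j
  proof -
    from that have "j \<noteq> r" by auto
    then show ?thesis using that level_parent[of j] by (auto simp: mem_successors_iff mem_sphere_iff)
  qed
  then show ?thesis by (auto simp: mem_sphere_iff level_successor)
qed

lemma finite_sphere [simp]: "finite (sphere n)"
  by (induction n) (simp_all add: sphere_0 sphere_Suc)

lemma sum_sphere_Suc:
  "(\<Sum>j\<in>sphere (Suc n). f j) = (\<Sum>i\<in>sphere n. \<Sum>j\<in>succs i. f j)"
  unfolding sphere_Suc by (rule sum.UNION_disjoint) (auto simp: mem_successors_iff)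

text \<open>\<open>anc i k\<close> is the ancestor of \<open>i\<close> at level \<open>k\<close>, only meaningful for \<open>k \<le> lev i\<close>.\<close>

definition anc :: "'i \<Rightarrow> nat \<Rightarrow> 'i" where
  "anc i k = (par ^^ (lev i - k)) i"

lemma anc_self [simp]: "anc i (lev i) = i"
  by (simp add: anc_def)

lemma anc_parent: "i \<noteq> r \<Longrightarrow> k \<le> lev (par i) \<Longrightarrow> anc i k = anc (par i) k"
  using level_parent[of i] by (simp add: anc_def Suc_diff_le funpow_swap1)

lemma level_anc: "k \<le> lev i \<Longrightarrow> lev (anc i k) = k"
proof (induction "lev i" arbitrary: i)
  case 0
  then show ?case by (simp add: anc_def)
next
  case (Suc n)
  from Suc(2) have "i \<noteq> r" by auto
  then show ?case
    using Suc level_parent[of i] anc_parent[of i k] anc_self[of i] by (cases "k = lev i") auto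
qed

lemma anc_0 [simp]: "anc i 0 = r"
  using level_anc[of 0 i] by simp

lemma parent_anc_Suc: "Suc k \<le> lev i \<Longrightarrow> par (anc i (Suc k)) = anc i k"
  using funpow.simps(2)[of "lev i - Suc k" par] by (simp add: anc_def Suc_diff_Suc del: funpow.simps)

lemma anc_anc: "l \<le> k \<Longrightarrow> k \<le> lev i \<Longrightarrow> anc (anc i k) l = anc i l"
  by (simp add: anc_def[of "anc i k"] level_anc) (simp add: anc_def funpow_add[symmetric, THEN fun_cong, simplified comp_def])

lemma anc_Suc_successor: "Suc k \<le> lev i \<Longrightarrow> anc i (Suc k) \<in> succs (anc i k)"
  using level_anc[of "Suc k" i] parent_anc_Suc[of k i] by (auto simp: mem_successors_iff)

lemma shortest_walk_set:
  "walk T i p r \<Longrightarrow> length p = Suc (lev i) \<Longrightarrow> set p = anc i ` {..lev i}"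
proof (induction "lev i" arbitrary: i p)
  case 0
  then show ?case by (auto simp: walk_def length_Suc_conv)
next
  case (Suc n)
  from Suc(2) have "i \<noteq> r" by auto
  from shortest_walk_Cons[OF Suc(3,4) \<open>i \<noteq> r\<close>] obtain j q where q: "p = i # q" "T i j"
      "walk T j q r" "lev i = Suc (lev j)" "length q = Suc (lev j)" .
  have j: "par i = j" using q by (intro parent_eqI) auto
  have "set q = anc j ` {..lev j}" using q Suc(1,2) by auto
  also have "\<dots> = anc i ` {..lev j}"
    using anc_parent[OF \<open>i \<noteq> r\<close>] j by (intro image_cong) auto
  finally show ?case using q(1,4) anc_self[of i] by (simp add: atMost_Suc)
qed

text \<open>All shortest walks visit the same sites, so the union in \<open>geodesic\<close> is one
  of equal sets; reversal turns walks from \<open>r\<close> into walks to \<open>r\<close>.\<close>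

lemma geodesic_root: "geodesic T r i = anc i ` {..lev i}"
proof -
  have *: "set p = anc i ` {..lev i}" if "walk T r p i" "length p = Suc (graph_dist T r i)" for p
    using shortest_walk_set[OF walk_rev[OF that(1)]] that(2)
    by (simp add: level_def graph_dist_sym)
  obtain p where p: "walk T r p i" "length p = Suc (graph_dist T r i)"
    using shortest_walk_exists[of r i] by blast
  then have "anc i ` {..lev i} \<subseteq> geodesic T r i"
    unfolding geodesic_def *[OF p, symmetric] by blast
  moreover have "geodesic T r i \<subseteq> anc i ` {..lev i}"
    unfolding geodesic_def using * by blast
  ultimately show ?thesis by blast
qed

lemma tree_le_iff: "tree_le T r i j \<longleftrightarrow> lev i \<le> lev j \<and> i = anc j (lev i)"
  by (auto simp: tree_le_def geodesic_root level_anc)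

lemma
  assumes "\<xi> \<in> tree_boundary T r"
  shows level_ray: "lev (\<xi> n) = n" and anc_ray: "k \<le> n \<Longrightarrow> anc (\<xi> n) k = \<xi> k"
proof -
  have 0: "\<xi> 0 = r" and S: "\<xi> (Suc n) \<in> succs (\<xi> n)" for n
    using assms by (auto simp: tree_boundary_def)
  show lev: "lev (\<xi> n) = n" for n
    by (induction n) (simp_all add: 0 level_successor[OF S])
  show "anc (\<xi> n) k = \<xi> k" if "k \<le> n"
    using that
  proof (induction n)
    case 0
    then show ?case using \<open>\<xi> 0 = r\<close> by simp
  next
    case (Suc n)
    have "\<xi> (Suc n) \<noteq> r" "par (\<xi> (Suc n)) = \<xi> n" using S[of n] by (auto simp: mem_successors_iff)
    then show ?case
      using Suc anc_self[of "\<xi> (Suc n)"] anc_parent[of "\<xi> (Suc n)" k]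
      by (cases "k = Suc n") (auto simp: lev)
  qed
qed

section \<open>Rays through a site and the boundary sigma-field\<close>

abbreviation cyl :: "'i \<Rightarrow> (nat \<Rightarrow> 'i) set" where "cyl \<equiv> boundary_at T r"
abbreviation bspace :: "(nat \<Rightarrow> 'i) measure" where "bspace \<equiv> boundary_space T r"

lemma cyl_anc_iff:
  "\<xi> \<in> tree_boundary T r \<Longrightarrow> k \<le> lev i \<Longrightarrow> \<xi> \<in> cyl (anc i k) \<longleftrightarrow> \<xi> k = anc i k"
  by (simp add: boundary_at_def level_anc)

lemma cyl_root: "cyl r = tree_boundary T r"
  by (auto simp: boundary_at_def tree_boundary_def)

lemma cyl_subset: "range cyl \<subseteq> Pow (tree_boundary T r)"
  by (auto simp: boundary_at_def)

lemma space_boundary [simp]: "space bspace = tree_boundary T r"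
  unfolding boundary_space_def by (rule space_measure_of[OF cyl_subset])

lemma cyl_sets [measurable, simp]: "cyl i \<in> sets bspace"
  using cyl_subset by (auto simp: boundary_space_def sets_measure_of)

text \<open>A ray through \<open>i\<close> passes next through a successor of \<open>i\<close>. As
  these pieces are disjoint and finitely many, additivity of a measure becomes the flow
  equation.\<close>

lemma cyl_successors: "cyl i = (\<Union>j\<in>succs i. cyl j)"
proof (intro set_eqI iffI)
  fix \<xi> assume "\<xi> \<in> cyl i"
  then have \<xi>: "\<xi> \<in> tree_boundary T r" "\<xi> (lev i) = i" by (auto simp: boundary_at_def)
  then have "\<xi> (Suc (lev i)) \<in> succs (\<xi> (lev i))" unfolding tree_boundary_def by blast
  then show "\<xi> \<in> (\<Union>j\<in>succs i. cyl j)"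
    using \<xi> by (auto simp: boundary_at_def level_successor intro!: bexI[of _ "\<xi> (Suc (lev i))"])
next
  fix \<xi> assume "\<xi> \<in> (\<Union>j\<in>succs i. cyl j)"
  then obtain j where j: "j \<in> succs i" "\<xi> \<in> cyl j" by blast
  then have "\<xi> (Suc (lev i)) = j" "\<xi> \<in> tree_boundary T r" by (auto simp: boundary_at_def level_successor)
  moreover from this have "par (\<xi> (Suc (lev i))) = \<xi> (lev i)"
    by (auto simp: tree_boundary_def mem_successors_iff)
  ultimately show "\<xi> \<in> cyl i" using j by (auto simp: boundary_at_def mem_successors_iff)
qed

lemma disjoint_cyl_successors: "disjoint_family_on cyl (succs i)"
  unfolding disjoint_family_on_def by (auto simp: level_successor boundary_at_def)

end

section \<open>Harmonic functions and flows\<close>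

locale weighted_tree = rooted_tree T r
  for T :: "'i \<Rightarrow> 'i \<Rightarrow> bool" and r :: 'i +
  fixes w :: "nat \<Rightarrow> real"
  assumes w_pos: "0 < w n" and w_strict_mono: "strict_mono w"
begin

section \<open>Slopes, potentials and flows\<close>

abbreviation d :: "nat \<Rightarrow> real" where "d \<equiv> weight_diff w"

lemma weight_diff_pos [simp]: "0 < d n"
  using w_pos[of 0] w_strict_mono by (auto simp: weight_diff_def strict_mono_def)

lemma weight_diff_nonneg [simp]: "0 \<le> d n" and weight_diff_neq_0 [simp]: "d n \<noteq> 0"
  using weight_diff_pos[of n] by linarith+

lemma sum_weight_diff: "(\<Sum>k\<le>n. d k) = w n"
  by (induction n) (simp_all add: weight_diff_def)

definition slope :: "('i \<Rightarrow> real) \<Rightarrow> 'i \<Rightarrow> real" where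
  "slope h i = (h i - (if i = r then 0 else h (par i))) / d (lev i)"

definition potential :: "('i \<Rightarrow> real) \<Rightarrow> 'i \<Rightarrow> real" where
  "potential u i = (\<Sum>k\<le>lev i. d k * u (anc i k))"

definition flow :: "('i \<Rightarrow> real) \<Rightarrow> bool" where
  "flow u \<longleftrightarrow> (\<forall>i. (\<Sum>j\<in>succs i. u j) = u i)"

text \<open>This recursion makes \<open>slope\<close> and \<open>potential\<close> inverse to each
  other: the path to the parent lacks only the last summand.\<close>

lemma potential_parent:
  "potential u i = (if i = r then 0 else potential u (par i)) + d (lev i) * u i"
proof (cases "i = r")
  case False
  then show ?thesis
    using anc_parent[OF False] level_parent[OF False] anc_self[of i]
    by (simp add: potential_def)
qed (simp add: potential_def)

lemma slope_potential [simp]: "slope (potential u) = u"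
  by (rule ext) (simp add: slope_def potential_parent[of u])

lemma potential_slope [simp]: "potential (slope h) = h"
proof
  fix i show "potential (slope h) i = h i"
  proof (induction "lev i" arbitrary: i)
    case (Suc n)
    from Suc(2) have "i \<noteq> r" by auto
    then show ?case
      using Suc level_parent[of i] by (subst potential_parent) (simp add: slope_def)
  qed (simp add: potential_def slope_def)
qed

lemma slope_successor: "j \<in> succs i \<Longrightarrow> slope h j = (h j - h i) / d (Suc (lev i))"
  using level_successor[of j i] by (simp add: slope_def mem_successors_iff)

text \<open>Row \<open>i\<close> of the matrix applied to \<open>h\<close> is the sum of the slopes
  at the successors minus the slope at \<open>i\<close>. The root row fits because its diagonal
  contains the absorption rate \<open>1 / w 0\<close>.\<close>

lemma harmonic_iff_flow: "harmonic T r w h \<longleftrightarrow> flow (slope h)"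
proof -
  have "((\<lambda>j. Q_matrix T r w i j * h j) has_sum 0) UNIV \<longleftrightarrow> (\<Sum>j\<in>succs i. slope h j) = slope h i"
    for i
  proof -
    have irr: "i \<notin> succs i" using level_successor[of i i] by auto
    \<comment> \<open>A set, empty at the root, so that one decomposition of the row sum serves both
      cases.\<close>
    define P where "P = (if i = r then {} else {par i})"
    have P: "i \<notin> P" "P \<inter> succs i = {}" "finite P"
      using level_parent[of i] level_successor[of "par i" i] by (auto simp: P_def)
    have Qs: "Q_matrix T r w i j = inverse (d (Suc (lev i)))" if "j \<in> succs i" for j
      using that irr P level_successor[OF that]
      by (auto simp: Q_matrix_def P_def mem_successors_iff split: if_splits)
    have "((\<lambda>j. Q_matrix T r w i j * h j) has_sum 0) UNIV \<longleftrightarrow>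
      ((\<lambda>j. Q_matrix T r w i j * h j) has_sum 0) (insert i (P \<union> succs i))"
      by (rule has_sum_cong_neutral) (auto simp: Q_matrix_def P_def mem_successors_iff)
    also have "\<dots> \<longleftrightarrow> (\<Sum>j\<in>insert i (P \<union> succs i). Q_matrix T r w i j * h j) = 0"
      by (subst has_sum_finite_iff) (auto simp: P(3))
    also have "(\<Sum>j\<in>insert i (P \<union> succs i). Q_matrix T r w i j * h j) =
      Q_matrix T r w i i * h i + (\<Sum>j\<in>P. Q_matrix T r w i j * h j) + (\<Sum>j\<in>succs i. Q_matrix T r w i j * h j)"
      using P irr by (simp add: sum.union_disjoint)
    \<comment> \<open>Write \<open>h j = (h j - h i) + h i\<close>: the surplus cancels against the
      successor part of the diagonal entry.\<close>
    also have "(\<Sum>j\<in>succs i. Q_matrix T r w i j * h j) =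
      (\<Sum>j\<in>succs i. slope h j) + card (succs i) * (inverse (d (Suc (lev i))) * h i)"
    proof -
      have "(\<Sum>j\<in>succs i. Q_matrix T r w i j * h j) =
        (\<Sum>j\<in>succs i. slope h j + inverse (d (Suc (lev i))) * h i)"
        by (rule sum.cong) (simp_all add: Qs slope_successor divide_inverse algebra_simps)
      then show ?thesis by (simp add: sum.distrib)
    qed
    also have "Q_matrix T r w i i * h i + (\<Sum>j\<in>P. Q_matrix T r w i j * h j) =
      - slope h i - card (succs i) * (inverse (d (Suc (lev i))) * h i)"
    proof (cases "i = r")
      case False
      then have "par i \<noteq> i" using level_parent[of i] by auto
      with False show ?thesis
        by (simp add: P_def Q_matrix_def slope_def divide_inverse algebra_simps)
    qed (simp add: P_def Q_matrix_def slope_def divide_inverse algebra_simps)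
    finally show ?thesis by auto
  qed
  then show ?thesis by (simp add: harmonic_def flow_def)
qed

text \<open>The weight differences up to level \<open>m\<close> add up to \<open>w m\<close>, and
  the levels where the ray agrees with the path from \<open>r\<close> to \<open>i\<close> form an
  initial segment. The kernel thus becomes a finite combination of indicators, easy to
  integrate.\<close>

lemma U_boundary_eq:
  assumes "\<xi> \<in> tree_boundary T r"
  shows "U_boundary T r w i \<xi> = (\<Sum>k\<le>lev i. d k * indicator (cyl (anc i k)) \<xi>)"
proof -
  define K where "K = {k. k \<le> lev i \<and> \<xi> k = anc i k}"
  have 0: "0 \<in> K" using assms by (simp add: K_def tree_boundary_def)
  have fin: "finite K" unfolding K_def by simp
  have "geodesic T r i \<inter> range \<xi> = \<xi> ` K"
  proof (intro set_eqI iffI)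
    fix j assume "j \<in> geodesic T r i \<inter> range \<xi>"
    then obtain k n where kn: "j = anc i k" "k \<le> lev i" "j = \<xi> n" unfolding geodesic_root by blast
    moreover from this have "n = k" using level_anc[of k i] level_ray[OF assms, of n] by simp
    ultimately show "j \<in> \<xi> ` K" by (auto simp: K_def)
  next
    fix j assume "j \<in> \<xi> ` K"
    then obtain k where "j = \<xi> k" "k \<le> lev i" "\<xi> k = anc i k" by (auto simp: K_def)
    then show "j \<in> geodesic T r i \<inter> range \<xi>" unfolding geodesic_root by blast
  qed
  then have lev: "lev ` (geodesic T r i \<inter> range \<xi>) = K"
    using level_ray[OF assms] by (simp add: image_image)
  \<comment> \<open>A site determines its ancestors, so agreement at level \<open>m\<close> forces
    agreement at every lower level.\<close>
  have down: "k \<in> K" if "k \<le> m" "m \<in> K" for k m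
    using that anc_ray[OF assms, of k m] anc_anc[of k m i] by (simp add: K_def)
  have "Max K \<in> K" using Max_in[OF fin] 0 by blast
  then have K: "{..Max K} = K"
    using Max_ge[OF fin] down by blast
  have "(\<Sum>k\<le>lev i. d k * indicator (cyl (anc i k)) \<xi>) = (\<Sum>k\<in>K. d k)"
    using assms by (intro sum.mono_neutral_cong_right) (auto simp: K_def cyl_anc_iff indicator_def)
  also have "\<dots> = w (Max K)" using sum_weight_diff[of "Max K"] by (simp only: K)
  finally show ?thesis by (simp add: U_boundary_def lev)
qed

lemma integral_U_boundary:
  assumes "finite_measure N" "sets N = sets bspace"
  shows "(\<integral>\<xi>. U_boundary T r w i \<xi> \<partial>N) = potential (\<lambda>i. measure N (cyl i)) i"
proof -
  interpret finite_measure N by fact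
  have [measurable]: "cyl j \<in> sets N" for j using assms(2) by simp
  have "space N = tree_boundary T r" using sets_eq_imp_space_eq[OF assms(2)] by simp
  then have "(\<integral>\<xi>. U_boundary T r w i \<xi> \<partial>N) =
      (\<integral>\<xi>. (\<Sum>k\<le>lev i. d k * indicator (cyl (anc i k)) \<xi>) \<partial>N)"
    by (intro Bochner_Integration.integral_cong) (auto simp: U_boundary_eq)
  also have "\<dots> = (\<Sum>k\<le>lev i. d k * measure N (cyl (anc i k)))"
    by (subst Bochner_Integration.integral_sum) (auto simp: emeasure_eq_measure)
  finally show ?thesis by (simp add: potential_def)
qed

lemma flow_measure:
  assumes "finite_measure N" "sets N = sets bspace"
  shows "flow (\<lambda>i. measure N (cyl i))"
  unfolding flow_def
proof
  fix i
  interpret finite_measure N by fact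
  show "(\<Sum>j\<in>succs i. measure N (cyl j)) = measure N (cyl i)"
    unfolding cyl_successors[of i]
    by (rule sym, rule finite_measure_finite_Union) (auto simp: assms disjoint_cyl_successors)
qed

lemma potential_mono:
  assumes "\<And>i. 0 \<le> u i" shows "monotone (tree_le T r) (\<le>) (potential u)"
proof (rule monotoneI)
  fix i j assume "tree_le T r i j"
  then have ij: "lev i \<le> lev j" "anc j (lev i) = i" by (auto simp: tree_le_iff)
  then have "potential u i = (\<Sum>k\<le>lev i. d k * u (anc j k))"
    using anc_anc[of _ "lev i" j] unfolding potential_def by (intro sum.cong) auto
  also have "\<dots> \<le> potential u j"
    unfolding potential_def using ij assms by (intro sum_mono2) auto
  finally show "potential u i \<le> potential u j" .
qed

end

section \<open>Flows and measures on the boundary\<close>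

context weighted_tree begin

section \<open>Signed measures and their values on cylinders\<close>

lemma sum_sphere_flow: "flow u \<Longrightarrow> (\<Sum>i\<in>sphere n. u i) = u r"
  by (induction n) (simp_all add: sphere_0 sum_sphere_Suc flow_def)

lemma potential_diff: "potential (\<lambda>i. u i - v i) i = potential u i - potential v i"
  by (simp add: potential_def right_diff_distrib sum_subtractf)

lemma signed_integral_U_boundary:
  assumes "finite_signed_measure bspace \<nu>"
  shows "signed_integral bspace \<nu> (U_boundary T r w i) = potential (\<lambda>i. \<nu> (cyl i)) i"
proof -
  note fsm = assms signed_measure_uminus[OF assms]
  show ?thesis
    using integral_U_boundary[OF finite_measure_positive_part[OF fsm(1)] sets_positive_part]
      integral_U_boundary[OF finite_measure_positive_part[OF fsm(2)] sets_positive_part]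
    by (simp add: signed_integral_def jordan_decomposition[OF assms] negative_part_def potential_diff)
qed

text \<open>Both sides of the integral equation are potentials, and \<open>potential\<close> is
  injective with inverse \<open>slope\<close>.\<close>

lemma represents_iff:
  "represents T r w \<nu> h \<longleftrightarrow>
    finite_signed_measure bspace \<nu> \<and> slope h = (\<lambda>i. \<nu> (cyl i))"
proof -
  have "h = potential (\<lambda>i. \<nu> (cyl i)) \<longleftrightarrow> slope h = (\<lambda>i. \<nu> (cyl i))"
    by (metis slope_potential potential_slope)
  then show ?thesis
    by (auto simp: represents_def signed_integral_U_boundary fun_eq_iff)
qed

text \<open>A nonnegative flow, normalised at each site, gives transition probabilities from a site to its
  successors. With independent choices of a successor at all sites, following the choices from the
  root yields a random ray, which passes through \<open>i\<close> with probability \<open>p i / p r\<close>.\<close>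

lemma measure_of_flow:
  assumes flow: "flow p" and nonneg: "\<And>i. 0 \<le> p i"
  shows "\<exists>N. finite_measure N \<and> sets N = sets bspace \<and> (\<forall>i. measure N (cyl i) = p i)"
proof -
  \<comment> \<open>Where \<open>p x = 0\<close> the quotients do not form a probability; the
    uniform law is a default that keeps the sum equal to 1.\<close>
  define K where "K x j = (if p x = 0 then 1 / card (succs x) else p j / p x)" for x j
  define M where "M x = point_measure (succs x) (\<lambda>j. ennreal (K x j))" for x
  have p: "(\<Sum>j\<in>succs x. p j) = p x" for x using flow by (simp add: flow_def)
  have K_nonneg: "0 \<le> K x j" for x j using nonneg by (simp add: K_def)
  have "card (succs x) \<noteq> 0" for x using successors_nonempty by simp
  then have "(\<Sum>j\<in>succs x. K x j) = 1" for x
    using p[of x] by (cases "p x = 0") (simp_all add: K_def sum_divide_distrib[symmetric])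
  then have prob: "prob_space (M x)" for x
    by (intro prob_spaceI)
      (simp add: M_def space_point_measure emeasure_point_measure_finite K_nonneg)
  then interpret product_prob_space M UNIV by (rule product_prob_spaceI)
  define ray where "ray \<omega> = rec_nat r (\<lambda>_ x. \<omega> x)" for \<omega> :: "'i \<Rightarrow> 'i"
  have ray_0: "ray \<omega> 0 = r" and ray_Suc: "ray \<omega> (Suc n) = \<omega> (ray \<omega> n)" for \<omega> n
    by (simp_all add: ray_def)
  have space: "space (PiM UNIV M) = (\<Pi>\<^sub>E x\<in>UNIV. succs x)"
    by (simp add: space_PiM M_def space_point_measure)
  have ray: "ray \<omega> \<in> tree_boundary T r" if "\<omega> \<in> space (PiM UNIV M)" for \<omega>
    using that by (auto simp: space tree_boundary_def ray_0 ray_Suc PiE_iff)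
  \<comment> \<open>The ray reaches \<open>i\<close> iff every proper ancestor of \<open>i\<close>
    chooses the next site on the path to \<open>i\<close>. \<open>J i\<close> collects these
    ancestors and \<open>X i x\<close> the required choice, so the event depends on finitely many
    coordinates.\<close>
  define J where "J i = anc i ` {..<lev i}" for i
  define X where "X i x = {anc i (Suc (lev x))}" for i x
  have X: "X i x \<in> sets (M x)" if "x \<in> J i" for i x
    using that anc_Suc_successor[of "lev x" i]
    by (auto simp: J_def X_def M_def sets_point_measure level_anc)
  have preimage: "ray -` cyl i \<inter> space (PiM UNIV M) = prod_emb UNIV M (J i) (PiE (J i) (X i))" for i
  proof -
    have "ray \<omega> \<in> cyl i \<longleftrightarrow> (\<forall>k<lev i. \<omega> (anc i k) = anc i (Suc k))"
      if \<omega>: "\<omega> \<in> space (PiM UNIV M)" for \<omega>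
    proof
      assume "ray \<omega> \<in> cyl i"
      then have "ray \<omega> (lev i) = i" by (simp add: boundary_at_def)
      then have anc: "ray \<omega> k = anc i k" if "k \<le> lev i" for k
        using anc_ray[OF ray[OF \<omega>] that] by simp
      show "\<forall>k<lev i. \<omega> (anc i k) = anc i (Suc k)"
      proof (intro allI impI)
        fix k assume "k < lev i"
        then show "\<omega> (anc i k) = anc i (Suc k)"
          using anc[of k] anc[of "Suc k"] ray_Suc[of \<omega> k] by simp
      qed
    next
      assume *: "\<forall>k<lev i. \<omega> (anc i k) = anc i (Suc k)"
      have "ray \<omega> k = anc i k" if "k \<le> lev i" for k
        using that by (induction k) (simp_all add: ray_0 ray_Suc *)
      then show "ray \<omega> \<in> cyl i" using ray[OF \<omega>] by (simp add: boundary_at_def)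
    qed
    moreover have "restrict \<omega> (J i) \<in> PiE (J i) (X i) \<longleftrightarrow> (\<forall>k<lev i. \<omega> (anc i k) = anc i (Suc k))" for \<omega>
      by (auto simp: J_def X_def level_anc PiE_iff)
    ultimately show ?thesis
      by (auto simp: prod_emb_def space_PiM)
  qed
  have [measurable]: "ray \<in> measurable (PiM UNIV M) bspace"
    unfolding boundary_space_def
  proof (rule measurable_measure_of[OF cyl_subset])
    fix A assume "A \<in> range cyl"
    then show "ray -` A \<inter> space (PiM UNIV M) \<in> sets (PiM UNIV M)"
      using X by (auto simp: preimage J_def intro!: sets_PiM_I)
  qed (use ray in auto)
  have prob_cyl: "emeasure (PiM UNIV M) (ray -` cyl i \<inter> space (PiM UNIV M)) =
      ennreal (\<Prod>k<lev i. K (anc i k) (anc i (Suc k)))" for i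
  proof -
    have "inj_on (anc i) {..<lev i}"
      by (rule inj_on_inverseI[of _ lev]) (simp add: level_anc)
    moreover have "emeasure (M (anc i k)) {anc i (Suc k)} = ennreal (K (anc i k) (anc i (Suc k)))"
      if "k < lev i" for k
      using that by (simp add: M_def emeasure_point_measure_finite anc_Suc_successor)
    ultimately have "(\<Prod>x\<in>J i. emeasure (M x) (X i x)) =
        (\<Prod>k<lev i. ennreal (K (anc i k) (anc i (Suc k))))"
      by (simp add: J_def X_def prod.reindex level_anc)
    moreover have "finite (J i)" by (simp add: J_def)
    ultimately show ?thesis
      unfolding preimage by (subst emeasure_PiM_emb) (auto simp: X prod_ennreal K_nonneg)
  qed
  \<comment> \<open>The quotients telescope. Where \<open>p\<close> is 0 the uniform default takes
    over, and the identity survives because nonnegativity and the flow equation make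
    \<open>p\<close> vanish at the successors too.\<close>
  have prod: "p r * (\<Prod>k<n. K (anc i k) (anc i (Suc k))) = p (anc i n)" if "n \<le> lev i" for n i
    using that
  proof (induction n)
    case (Suc n)
    have "p (anc i (Suc n)) = 0" if "p (anc i n) = 0"
      using that p[of "anc i n"] nonneg anc_Suc_successor[OF Suc(2)]
      by (simp add: sum_nonneg_eq_0_iff)
    then have "p (anc i n) * K (anc i n) (anc i (Suc n)) = p (anc i (Suc n))"
      by (simp add: K_def)
    with Suc show ?case by (simp add: mult.assoc[symmetric])
  qed simp
  \<comment> \<open>Scaling the law of the ray by \<open>p r\<close>, instead of dividing
    \<open>p\<close> by it, also covers \<open>p r = 0\<close>, where the zero measure
    results.\<close>
  define N where "N = scale_measure (ennreal (p r)) (distr (PiM UNIV M) bspace ray)"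
  have N: "emeasure N (cyl i) = ennreal (p i)" for i
    using prod[of "lev i" i] nonneg[of r]
    by (simp add: N_def emeasure_distr prob_cyl ennreal_mult'[symmetric])
  have "space N = cyl r" by (simp add: N_def cyl_root space_scale_measure)
  then have "finite_measure N" by (intro finite_measureI) (simp add: N)
  then show ?thesis
    using N nonneg by (intro exI[of _ N]) (simp add: N_def measure_def)
qed

text \<open>The positive variation of the flow below \<open>i\<close> is the increasing limit of the sums of
  \<open>max 0 (u j)\<close> over the descendants \<open>j\<close> of \<open>i\<close> in a fixed generation.\<close>

lemma flow_bounded_variation:
  assumes flow: "flow u" and bound: "\<And>n. (\<Sum>i\<in>sphere n. \<bar>u i\<bar>) \<le> C"
  shows "\<exists>p. flow p \<and> (\<forall>i. 0 \<le> p i \<and> u i \<le> p i)"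
proof -
  define F where "F = rec_nat (\<lambda>i. max 0 (u i)) (\<lambda>_ f i. \<Sum>j\<in>succs i. f j)"
  have F_0: "F 0 i = max 0 (u i)" and F_Suc: "F (Suc m) i = (\<Sum>j\<in>succs i. F m j)" for m i
    by (simp_all add: F_def)
  have F_nonneg: "0 \<le> F m i" for m i
    by (induction m arbitrary: i) (simp_all add: F_0 F_Suc sum_nonneg)
  \<comment> \<open>The positive part of a sum over successors is at most the sum of the positive
    parts.\<close>
  have "F m i \<le> F (Suc m) i" for m i
  proof (induction m arbitrary: i)
    case 0
    have "(\<Sum>j\<in>succs i. u j) \<le> (\<Sum>j\<in>succs i. F 0 j)"
      by (rule sum_mono) (simp add: F_0)
    then have "u i \<le> (\<Sum>j\<in>succs i. F 0 j)"
      using flow by (simp add: flow_def)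
    moreover have "0 \<le> (\<Sum>j\<in>succs i. F 0 j)" by (rule sum_nonneg) (rule F_nonneg)
    ultimately show ?case by (simp add: F_0[of i] F_Suc)
  next
    case (Suc m)
    show ?case unfolding F_Suc[of "Suc m"] F_Suc[of m i] by (rule sum_mono) (rule Suc)
  qed
  then have inc: "incseq (\<lambda>m. F m i)" for i by (rule incseq_SucI)
  \<comment> \<open>Generation \<open>m\<close> below level \<open>n\<close> is level
    \<open>n + m\<close>, which carries the uniform bound over to every
    \<open>F m i\<close>.\<close>
  have F_sphere: "(\<Sum>i\<in>sphere n. F m i) = (\<Sum>i\<in>sphere (n + m). max 0 (u i))" for m n
    by (induction m arbitrary: n) (simp_all add: F_0 F_Suc sum_sphere_Suc[symmetric])
  have le: "F m i \<le> C" for m i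
  proof -
    have "F m i \<le> (\<Sum>i\<in>sphere (lev i). F m i)"
      by (rule member_le_sum) (simp_all add: mem_sphere_iff F_nonneg)
    also have "\<dots> \<le> (\<Sum>i\<in>sphere (lev i + m). \<bar>u i\<bar>)"
      unfolding F_sphere by (rule sum_mono) auto
    also have "\<dots> \<le> C" by (rule bound)
    finally show ?thesis .
  qed
  have "\<exists>p. (\<lambda>m. F m i) \<longlonglongrightarrow> p" for i
  proof -
    have "\<forall>m. F m i \<le> C" using le by blast
    from incseq_convergent[OF inc this] show ?thesis by blast
  qed
  then have "\<exists>p. \<forall>i. (\<lambda>m. F m i) \<longlonglongrightarrow> p i" by (intro choice allI)
  then obtain p where p: "\<And>i. (\<lambda>m. F m i) \<longlonglongrightarrow> p i" by blast
  \<comment> \<open>The shifted sequence tends to \<open>p i\<close> and also, there being finitely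
    many successors, to the sum of their limits.\<close>
  have "(\<Sum>j\<in>succs i. p j) = p i" for i
  proof (rule LIMSEQ_unique)
    show "(\<lambda>m. F (Suc m) i) \<longlonglongrightarrow> p i" by (rule LIMSEQ_Suc[OF p])
    show "(\<lambda>m. F (Suc m) i) \<longlonglongrightarrow> (\<Sum>j\<in>succs i. p j)"
      unfolding F_Suc by (rule tendsto_sum) (rule p)
  qed
  moreover have "max 0 (u i) \<le> p i" for i
    using incseq_le[OF inc[of i] p[of i], of 0] by (simp add: F_0)
  ultimately show ?thesis unfolding flow_def by (intro exI[of _ p]) simp
qed

text \<open>\<open>u\<close> is the difference of the nonnegative flows \<open>p\<close> and
  \<open>p - u\<close>, each of which comes from a finite measure.\<close>

lemma signed_measure_of_bounded_variation:
  assumes flow: "flow u" and bound: "\<And>n. (\<Sum>i\<in>sphere n. \<bar>u i\<bar>) \<le> C"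
  shows "\<exists>\<nu>. finite_signed_measure bspace \<nu> \<and> u = (\<lambda>i. \<nu> (cyl i))"
proof -
  obtain p where p: "flow p" "\<And>i. 0 \<le> p i" "\<And>i. u i \<le> p i"
    using flow_bounded_variation[OF assms] by blast
  then have "flow (\<lambda>i. p i - u i)" "\<And>i. 0 \<le> p i - u i"
    using flow by (auto simp: flow_def sum_subtractf)
  from measure_of_flow[OF this] obtain N where
    N: "finite_measure N" "sets N = sets bspace" "\<And>i. measure N (cyl i) = p i - u i" by blast
  from measure_of_flow[OF p(1,2)] obtain P where
    P: "finite_measure P" "sets P = sets bspace" "\<And>i. measure P (cyl i) = p i" by blast
  have "finite_signed_measure bspace (\<lambda>A. measure P A - measure N A)"
    unfolding finite_signed_measure_def
    using finite_measure.finite_measure_UNION[OF P(1)] finite_measure.finite_measure_UNION[OF N(1)]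
    by (auto simp: P(2) N(2) intro!: sums_diff)
  then show ?thesis
    by (intro exI[of _ "\<lambda>A. measure P A - measure N A"]) (simp add: P N)
qed

text \<open>The cylinder masses of the two parts are flows, so their sums over any sphere equal
  their values at \<open>r\<close>, the total masses. Hence the bound is uniform in
  \<open>n\<close>.\<close>

lemma signed_measure_bounded_variation:
  assumes fsm: "finite_signed_measure bspace \<nu>"
  shows "(\<Sum>i\<in>sphere n. \<bar>\<nu> (cyl i)\<bar>) \<le>
    measure (positive_part bspace \<nu>) (cyl r) + measure (negative_part bspace \<nu>) (cyl r)"
proof -
  have "\<bar>\<nu> (cyl i)\<bar> \<le> measure (positive_part bspace \<nu>) (cyl i) + measure (negative_part bspace \<nu>) (cyl i)" for i
    unfolding jordan_decomposition[OF fsm cyl_sets]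
    by (smt (verit) measure_nonneg)
  then have "(\<Sum>i\<in>sphere n. \<bar>\<nu> (cyl i)\<bar>) \<le> (\<Sum>i\<in>sphere n.
      measure (positive_part bspace \<nu>) (cyl i) + measure (negative_part bspace \<nu>) (cyl i))"
    by (rule sum_mono)
  also have "\<dots> = measure (positive_part bspace \<nu>) (cyl r) + measure (negative_part bspace \<nu>) (cyl r)"
    unfolding sum.distrib negative_part_def
    by (simp add: sum_sphere_flow flow_measure finite_measure_positive_part fsm signed_measure_uminus)
  finally show ?thesis .
qed

text \<open>From level 1 on every site has a genuine parent, and all sites of a sphere share one
  weight difference, which is moved inside the sum.\<close>

lemma sum_abs_slope:
  assumes "n \<ge> 1"
  shows "1 / (w n - w (n - 1)) * (\<Sum>j\<in>sphere n. \<bar>h j - h (par j)\<bar>) = (\<Sum>j\<in>sphere n. \<bar>slope h j\<bar>)"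
proof -
  have "d n = w n - w (n - 1)" using assms by (simp add: weight_diff_def)
  moreover from this have "0 < w n - w (n - 1)" using weight_diff_pos[of n] by simp
  moreover have "j \<noteq> r \<and> lev j = n" if "j \<in> sphere n" for j
    using that assms by (auto simp: mem_sphere_iff)
  ultimately show ?thesis
    unfolding sum_distrib_left
    by (intro sum.cong) (auto simp: slope_def abs_divide)
qed

text \<open>Serves for both Jordan parts: the cylinder masses of a measure form a nonnegative flow,
  and \<open>f\<close> is its potential.\<close>

lemma harmonic_potential_measure:
  assumes "finite_measure N" "sets N = sets bspace"
    and f: "\<And>i. f i = (\<integral>\<xi>. U_boundary T r w i \<xi> \<partial>N)"
  shows "harmonic T r w f" "monotone (tree_le T r) (\<le>) f" "0 \<le> f i"
proof -
  have "f = potential (\<lambda>i. measure N (cyl i))"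
    by (rule ext) (simp add: f integral_U_boundary[OF assms(1,2)])
  then show "harmonic T r w f" "monotone (tree_le T r) (\<le>) f" "0 \<le> f i"
    using flow_measure[OF assms(1,2)]
    by (auto simp: harmonic_iff_flow potential_mono) (simp add: potential_def sum_nonneg)
qed

end

theorem theorem3p2:
  fixes T :: "'i \<Rightarrow> 'i \<Rightarrow> bool" and r :: 'i and w :: "nat \<Rightarrow> real" and h :: "'i \<Rightarrow> real"
  assumes "admissible_tree T r"
    and "\<And>n. 0 < w n" and "strict_mono w"
    and "transient T r w"
    and "bounded (range h)" and "harmonic T r w h"
  shows
    "((\<exists>\<nu>. represents T r w \<nu> h) \<longleftrightarrow>
      bdd_above ((\<lambda>n. 1 / (w n - w (n - 1)) *
        (\<Sum>j\<in>sphere_at T r n. \<bar>h j - h (parent T r j)\<bar>)) ` {1..})) \<and>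
     (bdd_above ((\<lambda>n. 1 / (w n - w (n - 1)) *
        (\<Sum>j\<in>sphere_at T r n. \<bar>h j - h (parent T r j)\<bar>)) ` {1..}) \<longrightarrow>
      (\<forall>\<nu>. represents T r w \<nu> h \<longrightarrow>
        (\<exists>hp hn.
          (\<forall>i. hp i = (\<integral>\<xi>. U_boundary T r w i \<xi> \<partial>positive_part (boundary_space T r) \<nu>)) \<and>
          (\<forall>i. hn i = (\<integral>\<xi>. U_boundary T r w i \<xi> \<partial>negative_part (boundary_space T r) \<nu>)) \<and>
          (\<forall>i. h i = hp i - hn i) \<and>
          (\<forall>i. 0 \<le> hp i) \<and> harmonic T r w hp \<and> monotone (tree_le T r) (\<le>) hp \<and>
          (\<forall>i. 0 \<le> hn i) \<and> harmonic T r w hn \<and> monotone (tree_le T r) (\<le>) hn)))"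
proof -
  interpret weighted_tree T r w
    using assms by unfold_locales
  have bdd: "bdd_above ((\<lambda>n. 1 / (w n - w (n - 1)) *
        (\<Sum>j\<in>sphere n. \<bar>h j - h (par j)\<bar>)) ` {1..}) \<longleftrightarrow>
      (\<exists>C. \<forall>n\<ge>1. (\<Sum>j\<in>sphere n. \<bar>slope h j\<bar>) \<le> C)"
  proof -
    have "(\<lambda>n. 1 / (w n - w (n - 1)) * (\<Sum>j\<in>sphere n. \<bar>h j - h (par j)\<bar>)) ` {1..} =
        (\<lambda>n. \<Sum>j\<in>sphere n. \<bar>slope h j\<bar>) ` {1..}"
      by (rule image_cong[OF refl], rule sum_abs_slope) simp
    moreover have "(\<forall>x\<in>(\<lambda>n. \<Sum>j\<in>sphere n. \<bar>slope h j\<bar>) ` {1..}. x \<le> C) \<longleftrightarrow>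
        (\<forall>n\<ge>1. (\<Sum>j\<in>sphere n. \<bar>slope h j\<bar>) \<le> C)" for C by auto
    ultimately show ?thesis unfolding bdd_above_def by simp
  qed
  have "(\<exists>\<nu>. represents T r w \<nu> h) \<longleftrightarrow> (\<exists>C. \<forall>n\<ge>1. (\<Sum>j\<in>sphere n. \<bar>slope h j\<bar>) \<le> C)"
  proof
    assume "\<exists>\<nu>. represents T r w \<nu> h"
    then obtain \<nu> where "finite_signed_measure bspace \<nu>" and \<nu>: "slope h = (\<lambda>i. \<nu> (cyl i))"
      by (auto simp: represents_iff)
    from signed_measure_bounded_variation[OF this(1)] show "\<exists>C. \<forall>n\<ge>1. (\<Sum>j\<in>sphere n. \<bar>slope h j\<bar>) \<le> C"
      unfolding \<nu> by blast
  next
    assume "\<exists>C. \<forall>n\<ge>1. (\<Sum>j\<in>sphere n. \<bar>slope h j\<bar>) \<le> C"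
    then obtain C where C: "\<And>n. n \<ge> 1 \<Longrightarrow> (\<Sum>j\<in>sphere n. \<bar>slope h j\<bar>) \<le> C" by blast
    \<comment> \<open>The assumed bound starts at level 1; level 0 consists of the root alone,
      whence the second argument of \<open>max\<close>.\<close>
    have "(\<Sum>j\<in>sphere n. \<bar>slope h j\<bar>) \<le> max C \<bar>slope h r\<bar>" for n
      using C[of n] by (cases "n = 0") (auto simp: sphere_0)
    then have "\<exists>\<nu>. finite_signed_measure bspace \<nu> \<and> slope h = (\<lambda>i. \<nu> (cyl i))"
      using assms(6) by (intro signed_measure_of_bounded_variation) (simp add: harmonic_iff_flow)
    then show "\<exists>\<nu>. represents T r w \<nu> h" by (simp add: represents_iff)
  qed
  moreover have "\<exists>hp hn.
          (\<forall>i. hp i = (\<integral>\<xi>. U_boundary T r w i \<xi> \<partial>positive_part bspace \<nu>)) \<and>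
          (\<forall>i. hn i = (\<integral>\<xi>. U_boundary T r w i \<xi> \<partial>negative_part bspace \<nu>)) \<and>
          (\<forall>i. h i = hp i - hn i) \<and>
          (\<forall>i. 0 \<le> hp i) \<and> harmonic T r w hp \<and> monotone (tree_le T r) (\<le>) hp \<and>
          (\<forall>i. 0 \<le> hn i) \<and> harmonic T r w hn \<and> monotone (tree_le T r) (\<le>) hn"
    if rep: "represents T r w \<nu> h" for \<nu>
  proof -
    have fsm: "finite_signed_measure bspace \<nu>" using rep by (simp add: represents_def)
    have N: "finite_measure (negative_part bspace \<nu>)" "sets (negative_part bspace \<nu>) = sets bspace"
      by (simp_all add: negative_part_def finite_measure_positive_part signed_measure_uminus fsm)
    note P = finite_measure_positive_part[OF fsm] sets_positive_part
    let ?hp = "\<lambda>i. \<integral>\<xi>. U_boundary T r w i \<xi> \<partial>positive_part bspace \<nu>"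
    let ?hn = "\<lambda>i. \<integral>\<xi>. U_boundary T r w i \<xi> \<partial>negative_part bspace \<nu>"
    show ?thesis
      using harmonic_potential_measure[OF P, of ?hp] harmonic_potential_measure[OF N, of ?hn] rep
      by (intro exI[of _ ?hp] exI[of _ ?hn]) (simp add: represents_def signed_integral_def)
  qed
  ultimately show ?thesis unfolding bdd by blast
qed

end
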